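(* For every $\epsilon>0$ there are only finitely many rational $\rho\in[0,1/2]$ with $a(\rho)\ge\epsilon$. In other words, $0$ is the only accumulation point of the image of the function $a$, i.e. of the set $\{a(\rho):\rho\in[0,1/2]\cap\mathbb{Q}\}$.
   Context: All graphs are finite and simple. For a graph $G$ with $n$ vertices, its edge density is $\rho(G)=\frac{2|E(G)|}{n^2}$ (normalized by $n^2/2$). $G$ is $\rho$-regular if it is regular and $\rho(G)=\rho$, i.e. every vertex has exactly $\rho n$ neighbours. Let $N_G(v)$ be the neighbourhood of $v$ and $$a(G)=\min_{(u,v)\notin E(G)}\frac{|N_G(u)\cap N_G(v)|}{n},$$ the minimum being over all pairs of vertices not forming an edge (pairs with $u=v$ may be included; they contribute the value $\rho$). For rational $\rho\in[0,1/2]$, $$a(\rho)=\max\{a(G): G \text{ is a triangle-free } \rho\text{-regular graph}\}$$ (the maximum is attained; it may equivalently be read as a supremum). *)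

theory Defs
  imports "HOL-Analysis.Analysis" "Graph_Theory.Pair_Digraph"
begin

text \<open>
  A finite simple graph is a \<^locale>\<open>pair_graph\<close>: a finite loopless symmetric digraph without
  parallel arcs, in which an undirected edge is the pair of its two opposite arcs.
\<close>

definition undirected_edges :: "'a pair_pre_digraph \<Rightarrow> 'a set set" where
  "undirected_edges G = {{u, v} |u v. (u, v) \<in> parcs G}"

definition neighbourhood :: "'a pair_pre_digraph \<Rightarrow> 'a \<Rightarrow> 'a set" where
  "neighbourhood G v = {w. (v, w) \<in> parcs G}"

definition triangle_free :: "'a pair_pre_digraph \<Rightarrow> bool" where
  "triangle_free G \<longleftrightarrow> (\<nexists>u v w. (u, v) \<in> parcs G \<and> (v, w) \<in> parcs G \<and> (w, u) \<in> parcs G)"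

definition edge_density :: "'a pair_pre_digraph \<Rightarrow> real" where
  "edge_density G = 2 * real (card (undirected_edges G)) / (real (card (pverts G)))\<^sup>2"

definition regular_graph :: "'a pair_pre_digraph \<Rightarrow> bool" where
  "regular_graph G \<longleftrightarrow> (\<exists>d. \<forall>v\<in>pverts G. card (neighbourhood G v) = d)"

definition density_regular :: "real \<Rightarrow> 'a pair_pre_digraph \<Rightarrow> bool" where
  "density_regular \<rho> G \<longleftrightarrow> regular_graph G \<and> edge_density G = \<rho>"

text \<open>
  The pairs with \<open>u = v\<close> are included. Hence the minimum ranges over a nonempty finite set
  for every graph with at least one vertex.
\<close>

definition min_codegree_density :: "'a pair_pre_digraph \<Rightarrow> real" where
  "min_codegree_density G =
     Min {real (card (neighbourhood G u \<inter> neighbourhood G v)) / real (card (pverts G)) |u v.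
            u \<in> pverts G \<and> v \<in> pverts G \<and> (u, v) \<notin> parcs G}"

text \<open>
  Every finite graph is isomorphic to one whose vertices are natural numbers, so it suffices
  to let \<open>G\<close> range over graphs on subsets of \<^typ>\<open>nat\<close>. The graph without vertices has no
  density and is excluded. The maximum over all \<open>G\<close> is written as a supremum; for rational
  \<open>\<rho> \<in> [0, 1/2]\<close> the set is nonempty (regular bipartite graphs) and contained in \<open>[0, \<rho>]\<close>.
  For any other \<open>\<rho>\<close> the set is empty and the value is irrelevant.
\<close>

definition max_codegree_density :: "real \<Rightarrow> real" where
  "max_codegree_density \<rho> =
     Sup {min_codegree_density G |G :: nat pair_pre_digraph.
            pair_graph G \<and> pverts G \<noteq> {} \<and> triangle_free G \<and> density_regular \<rho> G}"

end

theory Submission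
  imports Defs
begin

text \<open>
  Let \<open>G\<close> be a triangle-free graph on \<open>n\<close> vertices in which any two non-adjacent vertices have at
  least \<open>\<epsilon> n\<close> common neighbours. The point is that \<open>G\<close> is a blow-up of a graph whose size is
  bounded in terms of \<open>\<epsilon>\<close>, and that the density of a regular blow-up depends only on the graph that
  is blown up.

  \<^emph>\<open>Few twin classes.\<close> If \<open>N(u) \<noteq> N(v)\<close>, then \<open>N(u) - N(v)\<close> has at least \<open>\<epsilon> n\<close> elements
  (\<open>card_neighbourhood_diff_ge\<close>). Consider a set \<open>F\<close> of vertices with distinct neighbourhoods and
  some \<open>v \<in> F\<close>. By averaging, some \<open>s\<close> outside \<open>N(v)\<close> is adjacent to a fraction \<open>\<epsilon>\<close> of the
  vertices of \<open>F - {v}\<close>. Replace \<open>F\<close> by \<open>F \<inter> N(s)\<close>. Because there are no triangles, the union of the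
  neighbourhoods of the vertices of \<open>F \<inter> N(s)\<close> misses \<open>N(s)\<close>, and thus the at least \<open>\<epsilon> n\<close> vertices
  of \<open>N(s) \<inter> N(v)\<close>. So every step uses up \<open>\<epsilon> n\<close> further vertices, there are at most \<open>1 / \<epsilon>\<close> steps,
  and \<open>F\<close> has bounded size (\<open>card_UN_neighbourhood_ge\<close>, \<open>card_neighbourhoods_less\<close>).

  \<^emph>\<open>The quotient determines the density.\<close> If two regular graphs have the same quotient by their
  twin relations, then counting the pairs of a vertex of one graph and a vertex of the other whose
  classes are adjacent in the quotient, first along one graph and then along the other, gives
  \<open>n' d = n d'\<close> (\<open>degree_ratio_eq\<close>). There are finitely many quotients of bounded size, so there are
  finitely many densities.

  \<^emph>\<open>Accumulation points.\<close> All values of \<open>max_codegree_density\<close> at rational points of \<open>[0, 1/2]\<close> are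
  non-negative, so finiteness leaves \<open>0\<close> as the only possible accumulation point. It is one, because
  the value is positive at the infinitely many densities \<open>k / (3 k - 1)\<close>, as the Andrasfai graphs
  show.
\<close>

section \<open>Degrees, arcs and densities\<close>

lemma (in pair_graph) neighbourhood_subset: "neighbourhood G v \<subseteq> pverts G"
  unfolding neighbourhood_def using in_arcsD2 by auto

lemma (in pair_graph) finite_neighbourhood: "finite (neighbourhood G v)"
  using neighbourhood_subset pair_finite_verts by (rule finite_subset)

lemma (in pair_graph) in_neighbourhood_sym:
  "u \<in> neighbourhood G v \<longleftrightarrow> v \<in> neighbourhood G u"
  unfolding neighbourhood_def using arcs_symmetric by auto

lemma (in pair_graph) not_in_own_neighbourhood: "v \<notin> neighbourhood G v"
  unfolding neighbourhood_def using no_loops' by auto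

lemma (in pair_graph) card_parcs_eq: "card (parcs G) = 2 * card (undirected_edges G)"
proof -
  let ?E = "undirected_edges G"
  have E: "?E = (\<lambda>a. {fst a, snd a}) ` parcs G"
    unfolding undirected_edges_def by force
  have fin: "finite ?E"
    unfolding E using pair_finite_arcs by simp
  have one: "{e \<in> ?E. {fst a, snd a} = e} = {{fst a, snd a}}" if "a \<in> parcs G" for a
    using that unfolding E by auto
  have two: "card {a \<in> parcs G. {fst a, snd a} = e} = 2" if "e \<in> ?E" for e
  proof -
    from that obtain u v where e: "e = {u, v}" and uv: "(u, v) \<in> parcs G"
      unfolding undirected_edges_def by auto
    have "{a \<in> parcs G. {fst a, snd a} = e} = {(u, v), (v, u)}"
      unfolding e using uv arcs_symmetric by (auto simp: doubleton_eq_iff)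
    moreover have "u \<noteq> v"
      using uv by (rule no_loops')
    ultimately show ?thesis by simp
  qed
  have "(\<Sum>a\<in>parcs G. card {e \<in> ?E. {fst a, snd a} = e}) = (\<Sum>e\<in>?E. 2)"
    using pair_finite_arcs fin two by (intro sum_multicount_gen) auto
  then show ?thesis
    by (simp add: one)
qed

lemma (in pair_graph) edge_density_eq:
  assumes "pverts G \<noteq> {}" and deg: "\<And>v. v \<in> pverts G \<Longrightarrow> card (neighbourhood G v) = d"
  shows "edge_density G = real d / real (card (pverts G))"
proof -
  have "parcs G = Sigma (pverts G) (neighbourhood G)"
    unfolding neighbourhood_def using in_arcsD1 by auto
  then have "card (parcs G) = (\<Sum>v\<in>pverts G. card (neighbourhood G v))"
    using pair_finite_verts finite_neighbourhood by (simp add: card_SigmaI)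
  then have "2 * card (undirected_edges G) = card (pverts G) * d"
    using deg card_parcs_eq by simp
  then have "2 * real (card (undirected_edges G)) = real (card (pverts G)) * real d"
    by (metis of_nat_mult of_nat_numeral)
  moreover have "card (pverts G) > 0"
    using assms(1) pair_finite_verts by (simp add: card_gt_0_iff)
  ultimately show ?thesis
    unfolding edge_density_def by (simp add: power2_eq_square)
qed

lemma (in pair_graph) finite_codegrees:
  "finite {real (card (neighbourhood G u \<inter> neighbourhood G v)) / real (card (pverts G)) |u v.
            u \<in> pverts G \<and> v \<in> pverts G \<and> (u, v) \<notin> parcs G}" (is "finite ?A")
proof -
  have "?A \<subseteq> (\<lambda>(u, v). real (card (neighbourhood G u \<inter> neighbourhood G v)) / real (card (pverts G)))
                ` (pverts G \<times> pverts G)"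
    by auto
  then show ?thesis
    using pair_finite_verts by (meson finite_SigmaI finite_imageI finite_subset)
qed

lemma (in pair_graph) min_codegree_density_le:
  assumes "u \<in> pverts G" "v \<in> pverts G" "(u, v) \<notin> parcs G"
  shows "min_codegree_density G
           \<le> real (card (neighbourhood G u \<inter> neighbourhood G v)) / real (card (pverts G))"
  unfolding min_codegree_density_def using finite_codegrees assms by (intro Min_le) auto

lemma (in pair_graph) min_codegree_density_attained:
  assumes "pverts G \<noteq> {}"
  obtains u v where "u \<in> pverts G" "v \<in> pverts G" "(u, v) \<notin> parcs G"
    "min_codegree_density G
       = real (card (neighbourhood G u \<inter> neighbourhood G v)) / real (card (pverts G))"
proof -
  let ?A = "{real (card (neighbourhood G u \<inter> neighbourhood G v)) / real (card (pverts G)) |u v.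
              u \<in> pverts G \<and> v \<in> pverts G \<and> (u, v) \<notin> parcs G}"
  obtain v where "v \<in> pverts G" "(v, v) \<notin> parcs G"
    using assms no_loops' by blast
  then have "?A \<noteq> {}" by blast
  then have "Min ?A \<in> ?A"
    using finite_codegrees by (intro Min_in)
  then show ?thesis
    using that unfolding min_codegree_density_def by blast
qed

lemma (in pair_graph) min_codegree_density_bounds:
  assumes "pverts G \<noteq> {}"
  shows "0 \<le> min_codegree_density G" and "min_codegree_density G \<le> 1"
proof -
  obtain u v where eq: "min_codegree_density G
      = real (card (neighbourhood G u \<inter> neighbourhood G v)) / real (card (pverts G))"
    using min_codegree_density_attained[OF assms] by blast
  show "0 \<le> min_codegree_density G"
    unfolding eq by simp
  have "card (neighbourhood G u \<inter> neighbourhood G v) \<le> card (pverts G)"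
    using neighbourhood_subset pair_finite_verts by (intro card_mono) auto
  then show "min_codegree_density G \<le> 1"
    unfolding eq by (intro divide_le_eq_1[THEN iffD2]) (use assms pair_finite_verts in \<open>auto simp: card_gt_0_iff\<close>)
qed

section \<open>Bounding the number of twin classes\<close>

locale codegree_graph = pair_graph G for G :: "'a pair_pre_digraph" +
  fixes \<epsilon> :: real
  assumes triangle_free: "triangle_free G"
    and eps_pos: "\<epsilon> > 0"
    and codegree: "\<And>u v. u \<in> pverts G \<Longrightarrow> v \<in> pverts G \<Longrightarrow> (u, v) \<notin> parcs G \<Longrightarrow>
      \<epsilon> * real (card (pverts G)) \<le> real (card (neighbourhood G u \<inter> neighbourhood G v))"

context codegree_graph
begin

lemma disjoint_neighbourhoods:
  assumes "u \<in> neighbourhood G v"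
  shows "neighbourhood G u \<inter> neighbourhood G v = {}"
  using triangle_free assms arcs_symmetric unfolding triangle_free_def neighbourhood_def by blast

text \<open>
  A vertex \<open>w\<close> of \<open>N(v) - N(u)\<close> has many common neighbours with \<open>u\<close>, and none of them lies in
  \<open>N(v)\<close>, since \<open>v\<close> is adjacent to \<open>w\<close>. So strict inclusions between neighbourhoods do not exist,
  and non-inclusions are robust.
\<close>

lemma card_neighbourhood_diff_ge_if_witness:
  assumes "u \<in> pverts G" "w \<in> neighbourhood G v" "w \<notin> neighbourhood G u"
  shows "\<epsilon> * real (card (pverts G)) \<le> real (card (neighbourhood G u - neighbourhood G v))"
proof -
  have "w \<in> pverts G"
    using assms(2) neighbourhood_subset by auto
  then have "\<epsilon> * real (card (pverts G)) \<le> real (card (neighbourhood G u \<inter> neighbourhood G w))"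
    using assms by (intro codegree) (auto simp: neighbourhood_def)
  also have "card (neighbourhood G u \<inter> neighbourhood G w) \<le> card (neighbourhood G u - neighbourhood G v)"
    using disjoint_neighbourhoods[OF assms(2)] finite_neighbourhood by (intro card_mono) auto
  finally show ?thesis by simp
qed

lemma card_neighbourhood_diff_ge:
  assumes "u \<in> pverts G" "v \<in> pverts G" "neighbourhood G u \<noteq> neighbourhood G v"
  shows "\<epsilon> * real (card (pverts G)) \<le> real (card (neighbourhood G u - neighbourhood G v))"
proof (cases "neighbourhood G v \<subseteq> neighbourhood G u")
  case False
  then show ?thesis
    using card_neighbourhood_diff_ge_if_witness[OF assms(1)] by blast
next
  case True
  then obtain w where "w \<in> neighbourhood G u" "w \<notin> neighbourhood G v"
    using assms(3) by blast
  then have "\<epsilon> * real (card (pverts G)) \<le> real (card (neighbourhood G v - neighbourhood G u))"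
    by (rule card_neighbourhood_diff_ge_if_witness[OF assms(2)])
  also have "neighbourhood G v - neighbourhood G u = {}"
    using True by blast
  finally show ?thesis by simp
qed

text \<open>
  By the previous lemma the sets \<open>N(u) - N(v)\<close> for \<open>u \<in> F - {v}\<close> cover the complement of
  \<open>N(v)\<close> at least \<open>\<epsilon> (card F - 1)\<close> times on average.
\<close>

lemma ex_nonneighbour_with_many_neighbours_in:
  assumes F: "F \<subseteq> pverts G" "inj_on (neighbourhood G) F" and v: "v \<in> F"
  obtains s where "s \<in> pverts G" "s \<notin> neighbourhood G v"
    "\<epsilon> * (real (card F) - 1) \<le> real (card (F \<inter> neighbourhood G s))"
proof -
  let ?N = "neighbourhood G" and ?n = "real (card (pverts G))"
  let ?S = "pverts G - ?N v" and ?c = "\<epsilon> * (real (card F) - 1)"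
  have finF: "finite F"
    using F(1) pair_finite_verts by (rule finite_subset)
  then have F1: "card F \<ge> 1"
    using v by (metis One_nat_def Suc_leI card_gt_0_iff empty_iff)
  have "{s \<in> ?S. u \<in> ?N s} = ?N u - ?N v" for u
    using neighbourhood_subset in_neighbourhood_sym by blast
  then have count: "(\<Sum>s\<in>?S. card {u \<in> F. u \<in> ?N s}) = (\<Sum>u\<in>F. card (?N u - ?N v))"
    using finF pair_finite_verts by (intro sum_multicount_gen) simp_all
  have "?c * ?n = (\<Sum>u\<in>F - {v}. \<epsilon> * ?n)"
    using v finF F1 by (simp add: of_nat_diff algebra_simps)
  also have "\<dots> \<le> (\<Sum>u\<in>F - {v}. real (card (?N u - ?N v)))"
    using F v by (intro sum_mono card_neighbourhood_diff_ge) (auto simp: inj_on_def)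
  also have "\<dots> \<le> (\<Sum>u\<in>F. real (card (?N u - ?N v)))"
    using finF by (intro sum_mono2) auto
  also have "\<dots> = (\<Sum>s\<in>?S. real (card {u \<in> F. u \<in> ?N s}))"
    using arg_cong[OF count, of real] by simp
  finally have lower: "?c * ?n \<le> (\<Sum>s\<in>?S. real (card {u \<in> F. u \<in> ?N s}))" .
  have "\<exists>s\<in>?S. ?c \<le> real (card {u \<in> F. u \<in> ?N s})"
  proof (rule ccontr)
    assume "\<not> ?thesis"
    then have small: "real (card {u \<in> F. u \<in> ?N s}) < ?c" if "s \<in> ?S" for s
      using that by force
    have "v \<in> ?S"
      using v F(1) not_in_own_neighbourhood by auto
    then have "card ?S > 0"
      using pair_finite_verts by (auto simp: card_gt_0_iff)
    then have "(\<Sum>s\<in>?S. real (card {u \<in> F. u \<in> ?N s})) < real (card ?S) * ?c"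
      using small by (intro sum_bounded_above_strict) auto
    also have "\<dots> \<le> ?n * ?c"
      using F1 eps_pos pair_finite_verts by (intro mult_right_mono) (auto intro: card_mono)
    finally show False
      using lower by (simp add: mult.commute)
  qed
  then obtain s where s: "s \<in> ?S" "?c \<le> real (card {u \<in> F. u \<in> ?N s})" by blast
  have "{u \<in> F. u \<in> ?N s} = F \<inter> ?N s" by blast
  then show ?thesis
    using that[of s] s by simp
qed

end

text \<open>
  The inverse of \<open>x \<mapsto> \<epsilon> (x - 1)\<close>, iterated: a set of at least this size survives \<open>k\<close> steps of the
  shrinking \<open>F \<mapsto> F \<inter> N(s)\<close>.
\<close>

primrec shrink_bound :: "real \<Rightarrow> nat \<Rightarrow> real" where
  "shrink_bound \<epsilon> 0 = 0"
| "shrink_bound \<epsilon> (Suc k) = shrink_bound \<epsilon> k / \<epsilon> + 1"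

lemma shrink_bound_nonneg: "\<epsilon> > 0 \<Longrightarrow> 0 \<le> shrink_bound \<epsilon> k"
  by (induction k) auto

context codegree_graph
begin

text \<open>
  Passing from \<open>F\<close> to \<open>F \<inter> N(s)\<close> removes \<open>N(s) \<inter> N(v)\<close> from the union of the neighbourhoods: a
  neighbour of \<open>s\<close> has no neighbour in \<open>N(s)\<close>. These are at least \<open>\<epsilon> n\<close> vertices, as \<open>s\<close> and \<open>v\<close>
  are not adjacent.
\<close>

lemma card_UN_neighbourhood_ge:
  assumes "F \<subseteq> pverts G" "inj_on (neighbourhood G) F" "shrink_bound \<epsilon> k \<le> real (card F)"
  shows "real k * (\<epsilon> * real (card (pverts G))) \<le> real (card (\<Union>v\<in>F. neighbourhood G v))"
  using assms
proof (induction k arbitrary: F)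
  case 0
  then show ?case by simp
next
  case (Suc k)
  let ?N = "neighbourhood G" and ?n = "real (card (pverts G))"
  have finF: "finite F"
    using Suc.prems(1) pair_finite_verts by (rule finite_subset)
  have "shrink_bound \<epsilon> k / \<epsilon> \<ge> 0"
    using shrink_bound_nonneg eps_pos by simp
  then have "real (card F) \<ge> 1"
    using Suc.prems(3) by simp
  then obtain v where v: "v \<in> F"
    by fastforce
  obtain s where s: "s \<in> pverts G" "s \<notin> ?N v"
      and large: "\<epsilon> * (real (card F) - 1) \<le> real (card (F \<inter> ?N s))"
    using ex_nonneighbour_with_many_neighbours_in[OF Suc.prems(1,2) v] by blast
  let ?F = "F \<inter> ?N s"
  have "shrink_bound \<epsilon> k \<le> \<epsilon> * (real (card F) - 1)"
    using Suc.prems(3) eps_pos by (simp add: field_simps)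
  with large have "shrink_bound \<epsilon> k \<le> real (card ?F)" by simp
  then have IH: "real k * (\<epsilon> * ?n) \<le> real (card (\<Union>u\<in>?F. ?N u))"
    using Suc.prems(1,2) by (intro Suc.IH) (auto intro: inj_on_subset)
  have step: "\<epsilon> * ?n \<le> real (card (?N s \<inter> ?N v))"
    using s v Suc.prems(1) in_neighbourhood_sym[of s v]
    by (intro codegree) (auto simp: neighbourhood_def)
  have "(\<Union>u\<in>?F. ?N u) \<inter> (?N s \<inter> ?N v) = {}"
    using disjoint_neighbourhoods by blast
  then have "card (\<Union>u\<in>?F. ?N u) + card (?N s \<inter> ?N v) = card ((\<Union>u\<in>?F. ?N u) \<union> (?N s \<inter> ?N v))"
    using finF finite_neighbourhood by (subst card_Un_disjoint) auto
  also have "\<dots> \<le> card (\<Union>u\<in>F. ?N u)"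
    using finF finite_neighbourhood v by (intro card_mono) auto
  finally show ?case
    using IH step by (simp add: algebra_simps flip: of_nat_add)
qed

lemma card_neighbourhoods_less:
  assumes "pverts G \<noteq> {}" "real k * \<epsilon> > 1"
  shows "real (card (neighbourhood G ` pverts G)) < shrink_bound \<epsilon> k"
proof (rule ccontr)
  assume "\<not> ?thesis"
  moreover obtain F where F: "F \<subseteq> pverts G" "inj_on (neighbourhood G) F"
      "neighbourhood G ` pverts G = neighbourhood G ` F"
    by (metis order_refl subset_image_inj)
  ultimately have "shrink_bound \<epsilon> k \<le> real (card F)"
    by (simp add: card_image)
  then have "real k * (\<epsilon> * real (card (pverts G))) \<le> real (card (\<Union>v\<in>F. neighbourhood G v))"
    using F by (intro card_UN_neighbourhood_ge)
  also have "\<dots> \<le> real (card (pverts G))"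
    using neighbourhood_subset pair_finite_verts by (intro of_nat_mono card_mono) auto
  finally have "(real k * \<epsilon>) * real (card (pverts G)) \<le> 1 * real (card (pverts G))"
    by (simp add: mult.assoc)
  moreover have "real (card (pverts G)) > 0"
    using assms(1) pair_finite_verts by (simp add: card_gt_0_iff)
  ultimately show False
    using assms(2) by (simp del: mult_1)
qed

end

section \<open>The twin quotient determines the density\<close>

definition quotient_graph :: "('a \<Rightarrow> nat) \<Rightarrow> 'a pair_pre_digraph \<Rightarrow> nat set \<times> (nat \<times> nat) set" where
  "quotient_graph c G = (c ` pverts G, (\<lambda>(u, v). (c u, c v)) ` parcs G)"

definition merges_only_twins :: "('a \<Rightarrow> nat) \<Rightarrow> 'a pair_pre_digraph \<Rightarrow> bool" where
  "merges_only_twins c G \<longleftrightarrow>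
     (\<forall>u\<in>pverts G. \<forall>v\<in>pverts G. c u = c v \<longrightarrow> neighbourhood G u = neighbourhood G v)"

lemma (in pair_graph) arc_iff_quotient_arc:
  assumes "merges_only_twins c G" "u \<in> pverts G" "v \<in> pverts G"
  shows "(u, v) \<in> parcs G \<longleftrightarrow> (c u, c v) \<in> snd (quotient_graph c G)"
proof
  assume "(c u, c v) \<in> snd (quotient_graph c G)"
  then obtain u' v' where arc: "(u', v') \<in> parcs G" and eq: "c u' = c u" "c v' = c v"
    unfolding quotient_graph_def by auto
  have "u' \<in> pverts G" "v' \<in> pverts G"
    using arc by (auto intro: in_arcsD1 in_arcsD2)
  then have "neighbourhood G u' = neighbourhood G u" "neighbourhood G v' = neighbourhood G v"
    using assms eq unfolding merges_only_twins_def by blast+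
  then show "(u, v) \<in> parcs G"
    using arc in_neighbourhood_sym unfolding neighbourhood_def by blast
qed (auto simp: quotient_graph_def)

lemma (in pair_graph) card_quotient_neighbours:
  assumes c: "merges_only_twins c G"
    and deg: "\<And>v. v \<in> pverts G \<Longrightarrow> card (neighbourhood G v) = d"
    and i: "i \<in> fst (quotient_graph c G)"
  shows "card {u \<in> pverts G. (c u, i) \<in> snd (quotient_graph c G)} = d"
    and "card {u \<in> pverts G. (i, c u) \<in> snd (quotient_graph c G)} = d"
proof -
  obtain v where v: "v \<in> pverts G" and "i = c v"
    using i unfolding quotient_graph_def by auto
  then have "{u \<in> pverts G. (i, c u) \<in> snd (quotient_graph c G)} = {u \<in> pverts G. u \<in> neighbourhood G v}"
    and "{u \<in> pverts G. (c u, i) \<in> snd (quotient_graph c G)} = {u \<in> pverts G. v \<in> neighbourhood G u}"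
    using arc_iff_quotient_arc[OF c, symmetric] by (simp_all add: neighbourhood_def cong: conj_cong)
  then have "{u \<in> pverts G. (i, c u) \<in> snd (quotient_graph c G)} = neighbourhood G v"
    and "{u \<in> pverts G. (c u, i) \<in> snd (quotient_graph c G)} = neighbourhood G v"
    using neighbourhood_subset in_neighbourhood_sym by blast+
  then show "card {u \<in> pverts G. (c u, i) \<in> snd (quotient_graph c G)} = d"
    and "card {u \<in> pverts G. (i, c u) \<in> snd (quotient_graph c G)} = d"
    using deg[OF v] by simp_all
qed

text \<open>
  Both sides count the pairs \<open>(u, u')\<close> of a vertex of \<open>G\<close> and a vertex of \<open>G'\<close> whose classes are
  adjacent in the common quotient: a class of the quotient has \<open>d\<close> neighbours when it is lifted to
  \<open>G\<close>, and \<open>d'\<close> neighbours when it is lifted to \<open>G'\<close>.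
\<close>

lemma degree_ratio_eq:
  fixes G :: "'a pair_pre_digraph" and G' :: "'b pair_pre_digraph"
  assumes G: "pair_graph G" "merges_only_twins c G"
      "\<And>v. v \<in> pverts G \<Longrightarrow> card (neighbourhood G v) = d"
    and G': "pair_graph G'" "merges_only_twins c' G'"
      "\<And>v. v \<in> pverts G' \<Longrightarrow> card (neighbourhood G' v) = d'"
    and eq: "quotient_graph c G = quotient_graph c' G'"
  shows "card (pverts G) * d' = card (pverts G') * d"
proof -
  interpret G: pair_graph G by fact
  interpret G': pair_graph G' by fact
  let ?R = "snd (quotient_graph c G)"
  have colours: "c ` pverts G = c' ` pverts G'"
    using eq by (simp add: quotient_graph_def)
  have "card {u \<in> pverts G. (c u, c' u') \<in> ?R} = d" if "u' \<in> pverts G'" for u'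
    using that colours by (intro G.card_quotient_neighbours(1) G) (auto simp: quotient_graph_def)
  then have "(\<Sum>u\<in>pverts G. card {u' \<in> pverts G'. (c u, c' u') \<in> ?R}) = (\<Sum>u'\<in>pverts G'. d)"
    using G.pair_finite_verts G'.pair_finite_verts by (intro sum_multicount_gen) auto
  moreover have "card {u' \<in> pverts G'. (c u, c' u') \<in> ?R} = d'" if "u \<in> pverts G" for u
    unfolding eq using that colours
    by (intro G'.card_quotient_neighbours(2) G') (auto simp: quotient_graph_def)
  ultimately show ?thesis by simp
qed

text \<open>
  Colouring each vertex by its neighbourhood merges exactly the twins. There are fewer than \<open>K\<close>
  neighbourhoods, so they can be renamed to numbers below \<open>K\<close>, which leaves finitely many quotients.
\<close>

lemma (in codegree_graph) ex_small_quotient: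
  assumes "pverts G \<noteq> {}" "real k * \<epsilon> > 1" "shrink_bound \<epsilon> k \<le> real K"
  obtains c where "merges_only_twins c G"
    "quotient_graph c G \<in> Pow {..<K} \<times> Pow ({..<K} \<times> {..<K})"
proof -
  let ?A = "neighbourhood G ` pverts G"
  have "card ?A \<le> card {..<K}"
    using card_neighbourhoods_less[OF assms(1,2)] assms(3) by simp
  moreover have "finite ?A"
    using pair_finite_verts by simp
  ultimately obtain f where f: "f ` ?A \<subseteq> {..<K}" "inj_on f ?A"
    using card_le_inj[of ?A "{..<K}"] by auto
  let ?c = "\<lambda>v. f (neighbourhood G v)"
  have "merges_only_twins ?c G"
    using f(2) unfolding merges_only_twins_def inj_on_def by blast
  moreover have "?c v < K" if "v \<in> pverts G" for v
    using f(1) that by auto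
  then have "quotient_graph ?c G \<in> Pow {..<K} \<times> Pow ({..<K} \<times> {..<K})"
    using in_arcsD1 in_arcsD2 unfolding quotient_graph_def by auto
  ultimately show ?thesis by (rule that)
qed

lemma finite_densities:
  assumes "\<epsilon> > 0"
  shows "finite {\<rho>. \<exists>G :: 'a pair_pre_digraph. pair_graph G \<and> pverts G \<noteq> {} \<and> triangle_free G
           \<and> density_regular \<rho> G \<and> \<epsilon> \<le> min_codegree_density G}" (is "finite ?D")
proof -
  obtain k :: nat where k: "real k * \<epsilon> > 1"
    using assms reals_Archimedean3 by blast
  obtain K :: nat where K: "shrink_bound \<epsilon> k \<le> real K"
    using real_arch_simple by blast
  let ?Q = "Pow {..<K} \<times> Pow ({..<K} \<times> {..<K})"
  define realizes where "realizes q \<rho> \<longleftrightarrow> (\<exists>(G :: 'a pair_pre_digraph) c d.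
      pair_graph G \<and> pverts G \<noteq> {} \<and> merges_only_twins c G \<and> quotient_graph c G = q
      \<and> (\<forall>v\<in>pverts G. card (neighbourhood G v) = d) \<and> \<rho> = real d / real (card (pverts G)))" for q \<rho>
  have ex: "\<exists>q\<in>?Q. realizes q \<rho>" if "\<rho> \<in> ?D" for \<rho>
  proof -
    obtain G :: "'a pair_pre_digraph" where G: "pair_graph G" "pverts G \<noteq> {}" "triangle_free G"
        "density_regular \<rho> G" "\<epsilon> \<le> min_codegree_density G"
      using \<open>\<rho> \<in> ?D\<close> by blast
    interpret pair_graph G by fact
    have n: "real (card (pverts G)) > 0"
      using G(2) pair_finite_verts by (simp add: card_gt_0_iff)
    interpret codegree_graph G \<epsilon>
    proof
      fix u v assume "u \<in> pverts G" "v \<in> pverts G" "(u, v) \<notin> parcs G"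
      then have "\<epsilon> \<le> real (card (neighbourhood G u \<inter> neighbourhood G v)) / real (card (pverts G))"
        using min_codegree_density_le G(5) by fastforce
      then show "\<epsilon> * real (card (pverts G)) \<le> real (card (neighbourhood G u \<inter> neighbourhood G v))"
        using n by (simp add: pos_le_divide_eq)
    qed (use assms G(3) in auto)
    obtain c where c: "merges_only_twins c G" "quotient_graph c G \<in> ?Q"
      using ex_small_quotient[OF G(2) k K] by blast
    obtain d where d: "\<And>v. v \<in> pverts G \<Longrightarrow> card (neighbourhood G v) = d"
      using G(4) unfolding density_regular_def regular_graph_def by blast
    have "\<rho> = real d / real (card (pverts G))"
      using edge_density_eq[OF G(2) d] G(4) unfolding density_regular_def by simp
    then have "realizes (quotient_graph c G) \<rho>"
      unfolding realizes_def using G(1,2) c(1) d by blast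
    then show ?thesis
      using c(2) by (rule bexI)
  qed
  have unique: "\<rho> = \<rho>'" if q: "realizes q \<rho>" and q': "realizes q \<rho>'" for q \<rho> \<rho>'
  proof -
    obtain G :: "'a pair_pre_digraph" and c d where G: "pair_graph G" "pverts G \<noteq> {}"
        "merges_only_twins c G" "quotient_graph c G = q"
        "\<forall>v\<in>pverts G. card (neighbourhood G v) = d" "\<rho> = real d / real (card (pverts G))"
      using q unfolding realizes_def by blast
    obtain G' :: "'a pair_pre_digraph" and c' d' where G': "pair_graph G'" "pverts G' \<noteq> {}"
        "merges_only_twins c' G'" "quotient_graph c' G' = q"
        "\<forall>v\<in>pverts G'. card (neighbourhood G' v) = d'" "\<rho>' = real d' / real (card (pverts G'))"
      using q' unfolding realizes_def by blast
    have "card (pverts G) * d' = card (pverts G') * d"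
      using G G' by (intro degree_ratio_eq[of G c d G' c' d']) auto
    then have "real (card (pverts G)) * real d' = real (card (pverts G')) * real d"
      by (metis of_nat_mult)
    moreover have "card (pverts G) \<noteq> 0" "card (pverts G') \<noteq> 0"
      using G(1,2) G'(1,2) by (auto simp: pair_graph_def pair_digraph_def pair_fin_digraph_def
          pair_fin_digraph_axioms_def)
    ultimately show ?thesis
      unfolding G(6) G'(6) by (simp add: frac_eq_eq mult.commute)
  qed
  have "?D \<subseteq> (\<lambda>q. THE \<rho>. realizes q \<rho>) ` ?Q"
  proof
    fix \<rho> assume "\<rho> \<in> ?D"
    then obtain q where q: "q \<in> ?Q" "realizes q \<rho>"
      using ex by blast
    then have "(THE \<rho>. realizes q \<rho>) = \<rho>"
      using unique by blast
    then show "\<rho> \<in> (\<lambda>q. THE \<rho>. realizes q \<rho>) ` ?Q"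
      using q(1) by blast
  qed
  moreover have "finite ?Q" by simp
  ultimately show ?thesis by (rule finite_surj[rotated])
qed

section \<open>Triangle-free circulant graphs\<close>

definition circulant :: "nat \<Rightarrow> nat set \<Rightarrow> nat pair_pre_digraph" where
  "circulant m S = \<lparr>pverts = {..<m}, parcs = {(x, y). x < m \<and> y < m \<and> (\<exists>s\<in>S. (x + s) mod m = y)}\<rparr>"

lemma add_mod_eq_self_iff:
  fixes x a m :: nat
  assumes "x < m"
  shows "(x + a) mod m = x \<longleftrightarrow> m dvd a"
  using mod_eq_dvd_iff_nat[of x "x + a" m] assms by simp

text \<open>
  Under the symmetry \<open>S = - S\<close> the last assumption says that no two elements of \<open>S\<close> add up to a
  third one modulo \<open>m\<close>.
\<close>

locale sum_free_connection_set =
  fixes m :: nat and S :: "nat set"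
  assumes subset: "S \<subseteq> {1..<m}"
    and symmetric: "\<And>s. s \<in> S \<Longrightarrow> m - s \<in> S"
    and sum_free: "\<And>r s t. r \<in> S \<Longrightarrow> s \<in> S \<Longrightarrow> t \<in> S \<Longrightarrow> \<not> m dvd r + s + t"
begin

lemma circulant_arc_sym:
  assumes "(x, y) \<in> parcs (circulant m S)"
  shows "(y, x) \<in> parcs (circulant m S)"
proof -
  obtain s where xy: "x < m" "y < m" and s: "s \<in> S" "(x + s) mod m = y"
    using assms unfolding circulant_def by auto
  have "s < m"
    using s(1) subset by auto
  then have "(y + (m - s)) mod m = (x + s + (m - s)) mod m"
    unfolding s(2)[symmetric] by (simp only: mod_add_left_eq)
  also have "x + s + (m - s) = x + m"
    using \<open>s < m\<close> by simp
  finally have "(y + (m - s)) mod m = x"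
    using xy(1) by simp
  then show ?thesis
    using xy symmetric[OF s(1)] unfolding circulant_def by auto
qed

lemma circulant_no_loop: "(x, x) \<notin> parcs (circulant m S)"
proof
  assume "(x, x) \<in> parcs (circulant m S)"
  then obtain s where "x < m" "s \<in> S" "(x + s) mod m = x"
    unfolding circulant_def by auto
  then have "m dvd s" and "0 < s" "s < m"
    using subset by (auto simp: add_mod_eq_self_iff)
  then show False
    using nat_dvd_not_less by blast
qed

lemma pair_graph_circulant: "pair_graph (circulant m S)"
proof
  have "parcs (circulant m S) \<subseteq> {..<m} \<times> {..<m}"
    unfolding circulant_def by auto
  then show "finite (parcs (circulant m S))"
    by (rule finite_subset) simp
  show "Digraph.symmetric (with_proj (circulant m S))"
    unfolding symmetric_def sym_def using circulant_arc_sym by simp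
  show "fst e \<noteq> snd e" if "e \<in> parcs (circulant m S)" for e
    using that circulant_no_loop by (cases e) auto
qed (auto simp: circulant_def)

lemma triangle_free_circulant: "triangle_free (circulant m S)"
  unfolding triangle_free_def
proof clarify
  fix u v w
  assume "(u, v) \<in> parcs (circulant m S)" "(v, w) \<in> parcs (circulant m S)"
    "(w, u) \<in> parcs (circulant m S)"
  then obtain r s t where "r \<in> S" "s \<in> S" "t \<in> S" and "u < m"
      and eqs: "(u + r) mod m = v" "(v + s) mod m = w" "(w + t) mod m = u"
    unfolding circulant_def by auto
  have "(u + (r + s + t)) mod m = u"
    using eqs by (metis mod_add_left_eq add.assoc)
  then have "m dvd r + s + t"
    using \<open>u < m\<close> by (simp only: add_mod_eq_self_iff)
  then show False
    using sum_free \<open>r \<in> S\<close> \<open>s \<in> S\<close> \<open>t \<in> S\<close> by blast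
qed

lemma card_neighbourhood_circulant:
  assumes "x < m"
  shows "card (neighbourhood (circulant m S) x) = card S"
proof -
  have "neighbourhood (circulant m S) x = (\<lambda>s. (x + s) mod m) ` S"
    using assms unfolding neighbourhood_def circulant_def by auto
  moreover have "inj_on (\<lambda>s. (x + s) mod m) S"
  proof (rule inj_onI)
    fix s t assume "s \<in> S" "t \<in> S" and eq: "(x + s) mod m = (x + t) mod m"
    then have "s < m" "t < m"
      using subset by auto
    moreover have "s mod m = t mod m"
      using eq unfolding nat_mod_eq_iff by auto
    ultimately show "s = t" by simp
  qed
  ultimately show ?thesis
    by (simp add: card_image)
qed

lemma density_regular_circulant:
  assumes "m > 0"
  shows "density_regular (real (card S) / real m) (circulant m S)"
proof -
  interpret pair_graph "circulant m S" by (rule pair_graph_circulant)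
  have verts: "pverts (circulant m S) = {..<m}"
    by (simp add: circulant_def)
  have "edge_density (circulant m S) = real (card S) / real (card (pverts (circulant m S)))"
    using assms card_neighbourhood_circulant by (intro edge_density_eq) (auto simp: verts)
  then show ?thesis
    unfolding density_regular_def regular_graph_def
    using card_neighbourhood_circulant by (auto simp: verts)
qed

end

text \<open>
  A sum of three odd residues is not divisible by the even number \<open>2 q\<close>; the resulting graphs are
  bipartite. For density \<open>p / q\<close> take the
  \<open>2 p\<close> odd residues closest to \<open>0\<close>; the bound \<open>2 p \<le> q\<close> keeps the residues of the two signs apart.
\<close>

lemma ex_circulant_of_density:
  fixes p q :: nat
  assumes "q > 0" "2 * p \<le> q"
  obtains S where "sum_free_connection_set (2 * q) S" "card S = 2 * p"
proof -
  let ?A = "(\<lambda>i. 2 * i + 1) ` {..<p}"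
  let ?B = "(\<lambda>s. 2 * q - s) ` ?A"
  have "sum_free_connection_set (2 * q) (?A \<union> ?B)"
  proof
    have odd: "odd s" if "s \<in> ?A \<union> ?B" for s
      using that assms by auto
    show "\<not> 2 * q dvd r + s + t" if "r \<in> ?A \<union> ?B" "s \<in> ?A \<union> ?B" "t \<in> ?A \<union> ?B" for r s t
      using odd[OF that(1)] odd[OF that(2)] odd[OF that(3)] by (meson dvd_mult_left even_add)
  qed (use assms in auto)
  moreover have "card (?A \<union> ?B) = 2 * p"
  proof -
    have "card ?A = p"
      by (subst card_image) (auto simp: inj_on_def)
    moreover have "card ?B = card ?A"
      using assms by (intro card_image) (auto simp: inj_on_def)
    moreover have "?A \<inter> ?B = {}"
      using assms by auto
    ultimately show ?thesis
      by (subst card_Un_disjoint) auto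
  qed
  ultimately show ?thesis by (rule that)
qed

text \<open>
  These are the connection sets of the Andrasfai graphs. Three residues from the middle third add up
  to more than the modulus and less than twice the modulus.
\<close>

lemma sum_free_middle_third:
  assumes "k \<ge> 1"
  shows "sum_free_connection_set (3 * k - 1) {k..2 * k - 1}"
proof
  fix r s t assume *: "r \<in> {k..2 * k - 1}" "s \<in> {k..2 * k - 1}" "t \<in> {k..2 * k - 1}"
  have bounds: "1 * (3 * k - 1) < r + s + t" "r + s + t < 2 * (3 * k - 1)"
    using * assms by auto
  show "\<not> 3 * k - 1 dvd r + s + t"
  proof
    assume "3 * k - 1 dvd r + s + t"
    then obtain j where j: "r + s + t = j * (3 * k - 1)"
      by (metis dvd_def mult.commute)
    with bounds have "1 < j" "j < 2"
      by (metis mult_less_cancel2)+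
    then show False by simp
  qed
qed (use assms in auto)

text \<open>
  With \<open>S = {k..2 k - 1}\<close> the differences of elements of \<open>S\<close> are exactly the residues outside \<open>S\<close>, so
  non-adjacent vertices have a common neighbour. For \<open>x \<le> y\<close> at distance less than \<open>k\<close> the
  vertex \<open>y + k\<close> is one; at distance at least \<open>2 k\<close>, where \<open>y\<close> precedes \<open>x\<close> on the cycle by less
  than \<open>k\<close>, the vertex \<open>x + k\<close> is one.
\<close>

lemma middle_third_common_neighbour:
  assumes k: "k \<ge> 1" and xy: "x \<le> y" "y < 3 * k - 1"
    and nonadj: "(x, y) \<notin> parcs (circulant (3 * k - 1) {k..2 * k - 1})"
  shows "\<exists>z. (x, z) \<in> parcs (circulant (3 * k - 1) {k..2 * k - 1})
           \<and> (y, z) \<in> parcs (circulant (3 * k - 1) {k..2 * k - 1})"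
proof -
  let ?m = "3 * k - 1" and ?S = "{k..2 * k - 1}"
  have arc: "(a, (a + s) mod ?m) \<in> parcs (circulant ?m ?S)" if "a < ?m" "s \<in> ?S" for a s
    using that k unfolding circulant_def by auto
  have "y - x \<notin> ?S"
    using arc[of x "y - x"] nonadj xy by auto
  then consider "y - x < k" | "y - x \<ge> 2 * k"
    by fastforce
  then show ?thesis
  proof cases
    case 1
    then have "(x, (x + (y - x + k)) mod ?m) \<in> parcs (circulant ?m ?S)"
      using xy k by (intro arc) auto
    moreover have "x + (y - x + k) = y + k"
      using xy(1) by simp
    moreover have "(y, (y + k) mod ?m) \<in> parcs (circulant ?m ?S)"
      using xy k by (intro arc) auto
    ultimately show ?thesis by auto
  next
    case 2
    let ?t = "?m - (y - x) + k"
    have "y + ?t = x + k + ?m"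
      using 2 xy k by simp
    then have "(y + ?t) mod ?m = (x + k) mod ?m"
      by (simp only: mod_add_self2)
    moreover have "(y, (y + ?t) mod ?m) \<in> parcs (circulant ?m ?S)"
      using xy k 2 by (intro arc) auto
    moreover have "(x, (x + k) mod ?m) \<in> parcs (circulant ?m ?S)"
      using xy k by (intro arc) auto
    ultimately show ?thesis by auto
  qed
qed

lemma min_codegree_density_middle_third_pos:
  assumes k: "k \<ge> 1"
  shows "min_codegree_density (circulant (3 * k - 1) {k..2 * k - 1}) > 0"
proof -
  let ?G = "circulant (3 * k - 1) {k..2 * k - 1}"
  interpret S: sum_free_connection_set "3 * k - 1" "{k..2 * k - 1}"
    using k by (rule sum_free_middle_third)
  interpret pair_graph ?G by (rule S.pair_graph_circulant)
  have verts: "pverts ?G = {..<3 * k - 1}"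
    by (simp add: circulant_def)
  have "pverts ?G \<noteq> {}"
    unfolding verts using k by (simp add: lessThan_empty_iff)
  then obtain u v where uv: "u \<in> pverts ?G" "v \<in> pverts ?G" "(u, v) \<notin> parcs ?G"
    and eq: "min_codegree_density ?G
               = real (card (neighbourhood ?G u \<inter> neighbourhood ?G v)) / real (card (pverts ?G))"
    by (rule min_codegree_density_attained)
  have "\<exists>z. (u, z) \<in> parcs ?G \<and> (v, z) \<in> parcs ?G"
  proof (cases "u \<le> v")
    case True
    then show ?thesis
      using uv k unfolding verts by (intro middle_third_common_neighbour) auto
  next
    case False
    moreover have "(v, u) \<notin> parcs ?G"
      using uv(3) S.circulant_arc_sym by blast
    ultimately have "\<exists>z. (v, z) \<in> parcs ?G \<and> (u, z) \<in> parcs ?G"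
      using uv k unfolding verts by (intro middle_third_common_neighbour) auto
    then show ?thesis by blast
  qed
  then have "neighbourhood ?G u \<inter> neighbourhood ?G v \<noteq> {}"
    unfolding neighbourhood_def by blast
  then have "card (neighbourhood ?G u \<inter> neighbourhood ?G v) > 0"
    using finite_neighbourhood by (simp add: card_gt_0_iff)
  then show ?thesis
    unfolding eq verts using k by (intro divide_pos_pos) simp_all
qed

section \<open>The values of the maximal codegree density\<close>

lemma bdd_above_min_codegree_densities:
  "bdd_above {min_codegree_density G |G :: nat pair_pre_digraph.
     pair_graph G \<and> pverts G \<noteq> {} \<and> triangle_free G \<and> density_regular \<rho> G}"
  using pair_graph.min_codegree_density_bounds(2) by (intro bdd_aboveI[of _ 1]) blast

lemma min_codegree_density_le_max_codegree_density:
  fixes G :: "nat pair_pre_digraph"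
  assumes "pair_graph G" "pverts G \<noteq> {}" "triangle_free G" "density_regular \<rho> G"
  shows "min_codegree_density G \<le> max_codegree_density \<rho>"
  unfolding max_codegree_density_def
  using assms by (intro cSup_upper bdd_above_min_codegree_densities) blast

lemma ex_triangle_free_of_density:
  assumes "\<rho> \<in> \<rat>" "0 \<le> \<rho>" "\<rho> \<le> 1 / 2"
  obtains G :: "nat pair_pre_digraph"
  where "pair_graph G" "pverts G \<noteq> {}" "triangle_free G" "density_regular \<rho> G"
proof -
  obtain p q :: nat where "q \<noteq> 0" and abs: "\<bar>\<rho>\<bar> = real p / real q"
    using Rats_abs_nat_div_natE[OF assms(1)] by metis
  have \<rho>: "\<rho> = real p / real q"
    using abs assms(2) by simp
  then have "2 * real p = (2 * \<rho>) * real q"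
    using \<open>q \<noteq> 0\<close> by simp
  also have "\<dots> \<le> 1 * real q"
    using assms(3) by (intro mult_right_mono) auto
  finally have "2 * p \<le> q" by linarith
  with \<open>q \<noteq> 0\<close> obtain S where "sum_free_connection_set (2 * q) S" and S: "card S = 2 * p"
    using ex_circulant_of_density[of q p] by blast
  then interpret sum_free_connection_set "2 * q" S by simp
  show ?thesis
  proof
    show "density_regular \<rho> (circulant (2 * q) S)"
      using density_regular_circulant \<open>q \<noteq> 0\<close> by (simp add: \<rho> S)
    show "pverts (circulant (2 * q) S) \<noteq> {}"
      using \<open>q \<noteq> 0\<close> by (simp add: circulant_def lessThan_empty_iff)
  qed (rule pair_graph_circulant triangle_free_circulant)+
qed

lemma max_codegree_density_nonneg:
  assumes "\<rho> \<in> \<rat>" "0 \<le> \<rho>" "\<rho> \<le> 1 / 2"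
  shows "0 \<le> max_codegree_density \<rho>"
proof -
  obtain G :: "nat pair_pre_digraph"
    where G: "pair_graph G" "pverts G \<noteq> {}" "triangle_free G" "density_regular \<rho> G"
    using ex_triangle_free_of_density[OF assms] by blast
  have "0 \<le> min_codegree_density G"
    using pair_graph.min_codegree_density_bounds(1) G(1,2) by blast
  also have "\<dots> \<le> max_codegree_density \<rho>"
    using G by (rule min_codegree_density_le_max_codegree_density)
  finally show ?thesis .
qed

lemma finite_large_max_codegree_density:
  assumes "\<epsilon> > 0"
  shows "finite {\<rho>::real. \<rho> \<in> \<rat> \<and> 0 \<le> \<rho> \<and> \<rho> \<le> 1 / 2 \<and> max_codegree_density \<rho> \<ge> \<epsilon>}" (is "finite ?L")
proof -
  \<comment> \<open>A supremum of at least \<open>\<epsilon>\<close> is only known to be approached, hence the passage to \<open>\<epsilon> / 2\<close>.\<close>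
  let ?D = "{\<rho>. \<exists>G :: nat pair_pre_digraph. pair_graph G \<and> pverts G \<noteq> {} \<and> triangle_free G
              \<and> density_regular \<rho> G \<and> \<epsilon> / 2 \<le> min_codegree_density G}"
  have "?L \<subseteq> ?D"
  proof
    fix \<rho> assume "\<rho> \<in> ?L"
    then have \<rho>: "\<rho> \<in> \<rat>" "0 \<le> \<rho>" "\<rho> \<le> 1 / 2" and large: "\<epsilon> \<le> max_codegree_density \<rho>"
      by simp_all
    let ?A = "{min_codegree_density G |G :: nat pair_pre_digraph.
                pair_graph G \<and> pverts G \<noteq> {} \<and> triangle_free G \<and> density_regular \<rho> G}"
    obtain G :: "nat pair_pre_digraph"
      where "pair_graph G" "pverts G \<noteq> {}" "triangle_free G" "density_regular \<rho> G"
      by (rule ex_triangle_free_of_density[OF \<rho>])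
    then have "min_codegree_density G \<in> ?A" by blast
    then have nonempty: "?A \<noteq> {}" by (rule ex_in_conv[THEN iffD1, OF exI])
    have "\<epsilon> / 2 < Sup ?A"
      using large assms unfolding max_codegree_density_def by linarith
    then obtain a where "a \<in> ?A" and a: "\<epsilon> / 2 < a"
      using nonempty by (rule less_cSupE)
    then obtain G :: "nat pair_pre_digraph"
      where "pair_graph G" "pverts G \<noteq> {}" "triangle_free G" "density_regular \<rho> G"
        "a = min_codegree_density G"
      by blast
    then show "\<rho> \<in> ?D"
      using a by (auto intro: less_imp_le)
  qed
  moreover have "finite ?D"
    using assms by (intro finite_densities) simp
  ultimately show ?thesis by (rule finite_subset)
qed

lemma max_codegree_density_Andrasfai_pos:
  assumes "k \<ge> 1"
  shows "max_codegree_density (real k / real (3 * k - 1)) > 0"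
proof -
  let ?G = "circulant (3 * k - 1) {k..2 * k - 1}"
  interpret sum_free_connection_set "3 * k - 1" "{k..2 * k - 1}"
    using assms by (rule sum_free_middle_third)
  have "card {k..2 * k - 1} = k"
    using assms by simp
  then have "density_regular (real k / real (3 * k - 1)) ?G"
    using density_regular_circulant assms by simp
  moreover have "pverts ?G \<noteq> {}"
    using assms by (simp add: circulant_def lessThan_empty_iff)
  ultimately have "min_codegree_density ?G \<le> max_codegree_density (real k / real (3 * k - 1))"
    using pair_graph_circulant triangle_free_circulant
    by (intro min_codegree_density_le_max_codegree_density)
  then show ?thesis
    using min_codegree_density_middle_third_pos[OF assms] by linarith
qed

lemma infinite_pos_max_codegree_density:
  "infinite {\<rho>::real. \<rho> \<in> \<rat> \<and> 0 \<le> \<rho> \<and> \<rho> \<le> 1 / 2 \<and> max_codegree_density \<rho> > 0}" (is "infinite ?P")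
proof
  assume "finite ?P"
  have "(\<lambda>k. real k / real (3 * k - 1)) ` {1..} \<subseteq> ?P"
    using max_codegree_density_Andrasfai_pos by (auto simp: field_simps of_nat_diff)
  then have "finite ((\<lambda>k. real k / real (3 * k - 1)) ` {1..})"
    using \<open>finite ?P\<close> by (rule finite_subset)
  moreover have "inj_on (\<lambda>k. real k / real (3 * k - 1)) {1..}"
    by (auto simp: inj_on_def field_simps of_nat_diff)
  ultimately have "finite {1::nat..}"
    by (rule finite_imageD)
  then show False
    using infinite_Ici by blast
qed

theorem corollary4p6:
  shows "(\<forall>\<epsilon>::real. \<epsilon> > 0 \<longrightarrow>
            finite {\<rho>::real. \<rho> \<in> \<rat> \<and> 0 \<le> \<rho> \<and> \<rho> \<le> 1 / 2 \<and> max_codegree_density \<rho> \<ge> \<epsilon>}) \<and>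
         (\<forall>x::real. x islimpt (max_codegree_density ` (\<rat> \<inter> {0..1 / 2})) \<longleftrightarrow> x = 0)"
proof (intro conjI allI impI iffI)
  fix \<epsilon> :: real
  assume "\<epsilon> > 0"
  then show "finite {\<rho>::real. \<rho> \<in> \<rat> \<and> 0 \<le> \<rho> \<and> \<rho> \<le> 1 / 2 \<and> max_codegree_density \<rho> \<ge> \<epsilon>}"
    by (rule finite_large_max_codegree_density)
next
  let ?I = "max_codegree_density ` (\<rat> \<inter> {0..1 / 2})"
  fix x :: real
  assume lim: "x islimpt ?I"
  show "x = 0"
  proof (rule ccontr)
    assume "x \<noteq> 0"
    then have pos: "\<bar>x\<bar> / 2 > 0" by simp
    have "?I \<inter> ball x (\<bar>x\<bar> / 2)
        \<subseteq> max_codegree_density ` {\<rho>. \<rho> \<in> \<rat> \<and> 0 \<le> \<rho> \<and> \<rho> \<le> 1 / 2 \<and> max_codegree_density \<rho> \<ge> \<bar>x\<bar> / 2}"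
    proof clarify
      fix \<rho> :: real
      assume \<rho>: "\<rho> \<in> \<rat>" "\<rho> \<in> {0..1 / 2}" and "max_codegree_density \<rho> \<in> ball x (\<bar>x\<bar> / 2)"
      moreover have "0 \<le> max_codegree_density \<rho>"
        using \<rho> by (intro max_codegree_density_nonneg) auto
      ultimately have "\<bar>x\<bar> / 2 \<le> max_codegree_density \<rho>"
        by (simp add: dist_real_def abs_if split: if_splits)
      then show "max_codegree_density \<rho> \<in> max_codegree_density `
          {\<rho>. \<rho> \<in> \<rat> \<and> 0 \<le> \<rho> \<and> \<rho> \<le> 1 / 2 \<and> max_codegree_density \<rho> \<ge> \<bar>x\<bar> / 2}"
        using \<rho> by auto
    qed
    then have "finite (?I \<inter> ball x (\<bar>x\<bar> / 2))"
      using finite_large_max_codegree_density[OF pos] by (rule finite_surj[rotated])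
    then show False
      using lim pos by (simp add: islimpt_eq_infinite_ball)
  qed
next
  let ?I = "max_codegree_density ` (\<rat> \<inter> {0..1 / 2})"
  let ?P = "{\<rho>::real. \<rho> \<in> \<rat> \<and> 0 \<le> \<rho> \<and> \<rho> \<le> 1 / 2 \<and> max_codegree_density \<rho> > 0}"
  have "\<exists>y\<in>?I. y \<noteq> 0 \<and> dist y 0 < e" if "e > 0" for e
  proof -
    have "\<not> ?P \<subseteq> {\<rho>. \<rho> \<in> \<rat> \<and> 0 \<le> \<rho> \<and> \<rho> \<le> 1 / 2 \<and> max_codegree_density \<rho> \<ge> e}"
      using infinite_pos_max_codegree_density finite_large_max_codegree_density[OF that]
        finite_subset by blast
    then obtain \<rho> where "\<rho> \<in> ?P" "max_codegree_density \<rho> < e"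
      by force
    then show ?thesis
      by (intro bexI[of _ "max_codegree_density \<rho>"]) auto
  qed
  then have "0 islimpt ?I"
    unfolding islimpt_approachable by blast
  then show "x islimpt ?I" if "x = 0" for x
    using that by simp
qed

end
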